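(* For every positive integer $n$, the $n\times n$ matrix $\mathcal B=\left[\frac{1}{\beta(i,j)}\right]_{i,j=1}^{n}$ is infinitely divisible and totally positive.
   Context: Here $\beta(x,y)=\frac{\Gamma(x)\Gamma(y)}{\Gamma(x+y)}$ is the beta function, so $\frac{1}{\beta(i,j)}=\frac{(i+j-1)!}{(i-1)!(j-1)!}$ for positive integers $i,j$. A complex $n\times n$ matrix $A$ is positive semidefinite if $x^*Ax\ge 0$ for all $x\in\mathbb C^n$. For a matrix $A=[a_{ij}]$ with $a_{ij}\ge 0$ and a nonnegative real $r$, $A^{\circ r}=[a_{ij}^r]$ is the entrywise power. An $n\times n$ matrix $A=[a_{ij}]$ with $a_{ij}\ge 0$ is called infinitely divisible if $A^{\circ r}$ is positive semidefinite for every real $r>0$. A matrix is called totally positive if all its minors are (strictly) positive. *)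

theory Defs
  imports
    "HOL-Analysis.Gamma_Function"
    "Jordan_Normal_Form.Conjugate"
    "Jordan_Normal_Form.Determinant"
    "Jordan_Normal_Form.DL_Submatrix"
begin

text \<open>
  The form below is \<open>x\<^sup>* A x\<close>. With the order on \<^typ>\<open>complex\<close> used here,
  \<open>0 \<le> z\<close> says that \<open>z\<close> is real and nonnegative.
\<close>

definition positive_semidefinite :: "complex mat \<Rightarrow> bool" where
  "positive_semidefinite A \<longleftrightarrow>
     square_mat A \<and> (\<forall>x \<in> carrier_vec (dim_row A). 0 \<le> (A *\<^sub>v x) \<bullet>c x)"

text \<open>
  Only used for \<open>r > 0\<close>, where \<open>0 powr r = 0\<close> is the intended value.
  For \<open>r = 0\<close> note that \<open>0 powr 0 = 0\<close> in HOL.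
\<close>

definition entrywise_power :: "real mat \<Rightarrow> real \<Rightarrow> real mat" where
  "entrywise_power A r = map_mat (\<lambda>a. a powr r) A"

definition infinitely_divisible :: "real mat \<Rightarrow> bool" where
  "infinitely_divisible A \<longleftrightarrow>
     square_mat A \<and>
     (\<forall>i < dim_row A. \<forall>j < dim_col A. 0 \<le> A $$ (i, j)) \<and>
     (\<forall>r > 0. positive_semidefinite (map_mat complex_of_real (entrywise_power A r)))"

text \<open>
  \<^const>\<open>submatrix\<close> lists the selected rows and columns in increasing order, so the
  determinants below are exactly the minors of \<open>A\<close>.
\<close>

definition totally_positive :: "real mat \<Rightarrow> bool" where
  "totally_positive A \<longleftrightarrow>
     (\<forall>I J. I \<subseteq> {..<dim_row A} \<longrightarrow> J \<subseteq> {..<dim_col A} \<longrightarrow> I \<noteq> {} \<longrightarrow> card I = card J \<longrightarrow>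
        0 < Determinant.det (submatrix A I J))"

text \<open>Matrix indices start at 0, hence the shift by one.\<close>

definition reciprocal_beta_matrix :: "nat \<Rightarrow> real mat" where
  "reciprocal_beta_matrix n = mat n n (\<lambda>(i, j). 1 / Beta (real (i + 1)) (real (j + 1)))"

end

theory Submission
  imports Defs "HOL-Analysis.Generalised_Binomial_Theorem"
begin

text \<open>
  \<^bold>\<open>Infinite divisibility.\<close> Up to a diagonal congruence the \<open>r\<close>-th entrywise power is the kernel
  \<open>\<Gamma>(a\<^sub>i + a\<^sub>j)\<^sup>r\<close> with \<open>a\<^sub>i = i + 1\<close>. In Gauss's limit
  \<open>\<Gamma>(z) = lim m! m\<^sup>z / (z (z + 1) \<cdots> (z + m))\<close> the numerator at \<open>z = a\<^sub>i + a\<^sub>j\<close> is again only a diagonal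
  congruence, and the denominator is a product of Cauchy kernels \<open>(a\<^sub>i + k/2) + (a\<^sub>j + k/2)\<close>. Since
  positive semidefiniteness survives limits, it is enough that multiplication by a kernel
  \<open>(b\<^sub>i + b\<^sub>j)\<^sup>-\<^sup>r\<close> with \<open>b > 0\<close> preserves it (\<open>psd_kernel_mult_Cauchy_power\<close>). The
  Cayley transform \<open>u = (b - 1) / (b + 1)\<close> turns \<open>b\<^sub>i + b\<^sub>j\<close> into a congruence of
  \<open>1 - u\<^sub>i u\<^sub>j\<close> with \<open>\<bar>u\<bar> < 1\<close>, and the binomial series of \<open>(1 - u\<^sub>i u\<^sub>j)\<^sup>-\<^sup>r\<close> has nonnegative
  coefficients and terms of rank one. This replaces both the Schur product theorem and the usual
  integral representation of \<open>x\<^sup>-\<^sup>r\<close>.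

  \<^bold>\<open>Total positivity.\<close> The entries are \<open>(i + 1)(i + 2) \<cdots> (i + j + 1) / j!\<close>, so every minor is a
  positive multiple of a determinant of rising factorials of increasing orders \<open>m\<^sub>j\<close> at increasing
  positive integers \<open>x\<^sub>i\<close>, a discrete analogue of a generalised Vandermonde determinant. The
  induction on its size (\<open>det_pochhammer_pos\<close>) is a discrete Rolle argument. After factors
  are pulled out of the rows, the first column is constant; subtracting consecutive rows
  removes it and leaves differences of rising factorials. These telescope into sums of rising
  factorials of order one less over the disjoint intervals between consecutive nodes. Expanding by
  multilinearity gives a nonempty sum of determinants of the same kind and smaller size.
\<close>

section \<open>Positive semidefinite kernels\<close>

definition psd_kernel :: "nat \<Rightarrow> (nat \<Rightarrow> nat \<Rightarrow> real) \<Rightarrow> bool" where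
  "psd_kernel n K \<longleftrightarrow> (\<forall>x. 0 \<le> (\<Sum>i<n. \<Sum>j<n. x i * x j * K i j))"

lemma psd_kernel_cong:
  assumes "psd_kernel n K" "\<And>i j. i < n \<Longrightarrow> j < n \<Longrightarrow> L i j = K i j"
  shows "psd_kernel n L"
proof -
  have "(\<Sum>i<n. \<Sum>j<n. x i * x j * L i j) = (\<Sum>i<n. \<Sum>j<n. x i * x j * K i j)" for x
    by (intro sum.cong refl) (simp add: assms(2))
  then show ?thesis
    using assms(1) by (simp add: psd_kernel_def)
qed

lemma psd_kernel_one: "psd_kernel n (\<lambda>i j. 1)"
proof -
  have "(\<Sum>i<n. \<Sum>j<n. x i * x j * 1) = (\<Sum>i<n. x i)\<^sup>2" for x :: "nat \<Rightarrow> real"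
    by (simp add: power2_eq_square sum_product)
  then show ?thesis
    by (simp add: psd_kernel_def)
qed

lemma psd_kernel_congruence:
  assumes "psd_kernel n K"
  shows "psd_kernel n (\<lambda>i j. d i * d j * K i j)"
  unfolding psd_kernel_def
proof
  fix x :: "nat \<Rightarrow> real"
  have "0 \<le> (\<Sum>i<n. \<Sum>j<n. (x i * d i) * (x j * d j) * K i j)"
    using assms unfolding psd_kernel_def by (rule allE[where x = "\<lambda>i. x i * d i"])
  then show "0 \<le> (\<Sum>i<n. \<Sum>j<n. x i * x j * (d i * d j * K i j))"
    by (simp add: mult_ac)
qed

lemma psd_kernel_limit:
  assumes psd: "eventually (\<lambda>m. psd_kernel n (K m)) sequentially"
    and lim: "\<And>i j. i < n \<Longrightarrow> j < n \<Longrightarrow> (\<lambda>m. K m i j) \<longlonglongrightarrow> L i j"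
  shows "psd_kernel n L"
  unfolding psd_kernel_def
proof
  fix x :: "nat \<Rightarrow> real"
  have "(\<lambda>m. \<Sum>i<n. \<Sum>j<n. x i * x j * K m i j) \<longlonglongrightarrow> (\<Sum>i<n. \<Sum>j<n. x i * x j * L i j)"
    by (intro tendsto_intros lim) auto
  then show "0 \<le> (\<Sum>i<n. \<Sum>j<n. x i * x j * L i j)"
  proof (rule tendsto_lowerbound)
    show "eventually (\<lambda>m. 0 \<le> (\<Sum>i<n. \<Sum>j<n. x i * x j * K m i j)) sequentially"
      using psd by eventually_elim (simp add: psd_kernel_def)
  qed simp
qed

text \<open>
  Each term of the power series multiplies the kernel by a matrix of rank one, which is a diagonal
  congruence; no general Schur product is involved.
\<close>

lemma psd_kernel_mult_power_series:
  assumes psd: "psd_kernel n K" and c: "\<And>k. 0 \<le> c k"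
    and sums: "\<And>i j. i < n \<Longrightarrow> j < n \<Longrightarrow> (\<lambda>k. c k * (u i * u j) ^ k) sums S i j"
  shows "psd_kernel n (\<lambda>i j. K i j * S i j)"
proof (rule psd_kernel_limit)
  show "(\<lambda>m. K i j * (\<Sum>k<m. c k * (u i * u j) ^ k)) \<longlonglongrightarrow> K i j * S i j"
    if "i < n" "j < n" for i j
    using sums[OF that] unfolding sums_def by (intro tendsto_intros)
  have "psd_kernel n (\<lambda>i j. K i j * (\<Sum>k<m. c k * (u i * u j) ^ k))" for m
    unfolding psd_kernel_def
  proof
    fix x :: "nat \<Rightarrow> real"
    have "0 \<le> (\<Sum>k<m. c k * (\<Sum>i<n. \<Sum>j<n. x i * x j * (u i ^ k * u j ^ k * K i j)))"
      using psd_kernel_congruence[OF psd] c by (auto intro!: sum_nonneg simp: psd_kernel_def)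
    also have "\<dots> = (\<Sum>k<m. \<Sum>i<n. \<Sum>j<n. x i * x j * (K i j * (c k * (u i * u j) ^ k)))"
      by (simp add: sum_distrib_left power_mult_distrib mult_ac)
    also have "\<dots> = (\<Sum>i<n. \<Sum>k<m. \<Sum>j<n. x i * x j * (K i j * (c k * (u i * u j) ^ k)))"
      by (rule sum.swap)
    also have "\<dots> = (\<Sum>i<n. \<Sum>j<n. \<Sum>k<m. x i * x j * (K i j * (c k * (u i * u j) ^ k)))"
      by (rule sum.cong[OF refl]) (rule sum.swap)
    finally show "0 \<le> (\<Sum>i<n. \<Sum>j<n. x i * x j * (K i j * (\<Sum>k<m. c k * (u i * u j) ^ k)))"
      by (simp add: sum_distrib_left)
  qed
  then show "eventually (\<lambda>m. psd_kernel n (\<lambda>i j. K i j * (\<Sum>k<m. c k * (u i * u j) ^ k))) sequentially"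
    by simp
qed

section \<open>Powers of Cauchy kernels and of the Gamma kernel\<close>

lemma negative_binomial_series:
  fixes z r :: real
  assumes "\<bar>z\<bar> < 1"
  shows "(\<lambda>k. pochhammer r k / fact k * z ^ k) sums (1 - z) powr (- r)"
proof -
  have "(\<lambda>k. ((- r) gchoose k) * (- z) ^ k) sums (1 + - z) powr (- r)"
    by (rule gen_binomial_real) (use assms in simp)
  moreover have "((- r) gchoose k) * (- z) ^ k = pochhammer r k / fact k * z ^ k" for k
  proof -
    have "((-1) ^ k * (-1) ^ k :: real) = 1"
      by (simp flip: power_mult_distrib)
    then show ?thesis
      by (simp add: gbinomial_pochhammer power_minus[of z] field_simps)
  qed
  ultimately show ?thesis
    by simp
qed

text \<open>
  The Cayley transform \<open>u = (a - 1) / (a + 1)\<close> maps the half line to the interval \<open>(-1, 1)\<close> and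
  satisfies \<open>a\<^sub>i + a\<^sub>j = (1 - u\<^sub>i u\<^sub>j) (a\<^sub>i + 1) (a\<^sub>j + 1) / 2\<close>.
\<close>

lemma psd_kernel_mult_Cauchy_power:
  assumes psd: "psd_kernel n K" and a: "\<And>i. 0 < a i" and r: "0 < (r :: real)"
  shows "psd_kernel n (\<lambda>i j. K i j * (a i + a j) powr (- r))"
proof -
  define u where "u i = (a i - 1) / (a i + 1)" for i
  define d where "d i = (a i + 1) / sqrt 2" for i
  have u: "\<bar>u i\<bar> < 1" for i
    using a[of i] by (auto simp: u_def abs_less_iff field_simps)
  have uu: "\<bar>u i * u j\<bar> < 1" for i j
    using mult_strict_mono'[of "\<bar>u i\<bar>" 1 "\<bar>u j\<bar>" 1] u by (simp add: abs_mult)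
  have "psd_kernel n (\<lambda>i j. K i j * (1 - u i * u j) powr (- r))"
  proof (rule psd_kernel_mult_power_series[OF psd])
    show "0 \<le> pochhammer r k / fact k" for k
      using pochhammer_nonneg[OF r] by simp
  qed (rule negative_binomial_series[OF uu])
  then have "psd_kernel n (\<lambda>i j. d i powr (- r) * d j powr (- r) * (K i j * (1 - u i * u j) powr (- r)))"
    by (rule psd_kernel_congruence)
  then show ?thesis
  proof (rule psd_kernel_cong)
    fix i j
    have d: "0 < d i" "0 < d j"
      using a[of i] a[of j] by (simp_all add: d_def)
    have nz: "a i + 1 \<noteq> 0" "a j + 1 \<noteq> 0"
      using a[of i] a[of j] by simp_all
    have dd: "d i * d j = (a i + 1) * (a j + 1) / 2"
      by (simp add: d_def)
    have uu_eq: "1 - u i * u j = 2 * (a i + a j) / ((a i + 1) * (a j + 1))"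
      using nz by (simp add: u_def divide_simps) (simp add: algebra_simps)
    have "a i + a j = d i * d j * (1 - u i * u j)"
      unfolding dd uu_eq using nz by simp
    moreover have "0 < 1 - u i * u j"
      using uu[of i j] by simp
    ultimately have "(a i + a j) powr (- r) = d i powr (- r) * d j powr (- r) * (1 - u i * u j) powr (- r)"
      using d by (simp add: powr_mult)
    then show "K i j * (a i + a j) powr (- r)
        = d i powr (- r) * d j powr (- r) * (K i j * (1 - u i * u j) powr (- r))"
      by simp
  qed
qed

lemma psd_kernel_pochhammer_power:
  assumes a: "\<And>i. 0 < a i" and r: "0 < (r :: real)"
  shows "psd_kernel n (\<lambda>i j. pochhammer (a i + a j) m powr (- r))"
proof (induction m)
  case 0
  then show ?case
    by (simp add: psd_kernel_one)
next
  case (Suc m)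
  have "psd_kernel n (\<lambda>i j. pochhammer (a i + a j) m powr (- r)
      * ((a i + real m / 2) + (a j + real m / 2)) powr (- r))"
    using Suc.IH a r by (intro psd_kernel_mult_Cauchy_power) (auto intro: add_pos_nonneg)
  then show ?case
  proof (rule psd_kernel_cong)
    fix i j
    have pos: "0 < a i + a j"
      using a[of i] a[of j] by simp
    have "pochhammer (a i + a j) (Suc m)
        = pochhammer (a i + a j) m * ((a i + real m / 2) + (a j + real m / 2))"
      by (simp add: pochhammer_rec' add_ac)
    then show "pochhammer (a i + a j) (Suc m) powr (- r) = pochhammer (a i + a j) m powr (- r)
        * ((a i + real m / 2) + (a j + real m / 2)) powr (- r)"
      using pos pochhammer_pos[OF pos, of m]
      by (simp add: powr_mult)
  qed
qed

lemma psd_kernel_Gamma_power: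
  assumes a: "\<And>i. 0 < a i" and r: "0 < (r :: real)"
  shows "psd_kernel n (\<lambda>i j. Gamma (a i + a j) powr r)"
proof (rule psd_kernel_limit)
  show "(\<lambda>m. Gamma_series (a i + a j) m powr r) \<longlonglongrightarrow> Gamma (a i + a j) powr r" for i j
  proof -
    have "0 < Gamma (a i + a j)"
      using a[of i] a[of j] by (intro Gamma_real_pos) simp
    then show ?thesis
      by (intro tendsto_intros) simp
  qed
  have "psd_kernel n (\<lambda>i j. Gamma_series (a i + a j) m powr r)" for m
  proof -
    define d where "d i = sqrt (fact m) * exp (a i * ln (real m))" for i
    have "psd_kernel n (\<lambda>i j. d i powr r * d j powr r * pochhammer (a i + a j) (m + 1) powr (- r))"
      by (intro psd_kernel_congruence psd_kernel_pochhammer_power a r)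
    then show ?thesis
    proof (rule psd_kernel_cong)
      fix i j
      have pos: "0 < a i + a j"
        using a[of i] a[of j] by simp
      have "d i * d j = fact m * exp ((a i + a j) * ln (real m))"
        by (simp add: d_def exp_add distrib_right)
      then have "Gamma_series (a i + a j) m = d i * d j / pochhammer (a i + a j) (m + 1)"
        by (simp add: Gamma_series_def)
      moreover have "0 < d i" "0 < d j" "0 < pochhammer (a i + a j) (m + 1)"
        using pochhammer_pos[OF pos, of "m + 1"] by (simp_all add: d_def)
      ultimately show "Gamma_series (a i + a j) m powr r
          = d i powr r * d j powr r * pochhammer (a i + a j) (m + 1) powr (- r)"
        by (simp add: powr_mult powr_divide powr_minus_divide)
    qed
  qed
  then show "eventually (\<lambda>m. psd_kernel n (\<lambda>i j. Gamma_series (a i + a j) m powr r)) sequentially"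
    by simp
qed

section \<open>From real kernels to Hermitian forms\<close>

text \<open>
  For a real symmetric kernel the Hermitian form at \<open>z = a + i b\<close> is the sum of the real forms at
  \<open>a\<close> and at \<open>b\<close>; the imaginary part cancels by symmetry.
\<close>

lemma positive_semidefinite_psd_kernel:
  assumes psd: "psd_kernel n K" and sym: "\<And>i j. K i j = K j i"
  shows "positive_semidefinite (mat n n (\<lambda>(i, j). complex_of_real (K i j)))"
    (is "positive_semidefinite ?A")
  unfolding positive_semidefinite_def
proof (intro conjI ballI)
  fix x :: "complex vec"
  assume "x \<in> carrier_vec (dim_row ?A)"
  then have x: "dim_vec x = n"
    by simp
  define a where "a i = Re (x $ i)" for i
  define b where "b i = Im (x $ i)" for i
  have "(?A *\<^sub>v x) \<bullet>c x = (\<Sum>i<n. \<Sum>j<n. complex_of_real (K i j) * x $ j * cnj (x $ i))"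
    using x by (simp add: scalar_prod_def sum_distrib_right lessThan_atLeast0)
  moreover have "Re \<dots> = (\<Sum>i<n. \<Sum>j<n. a i * a j * K i j) + (\<Sum>i<n. \<Sum>j<n. b i * b j * K i j)"
    by (simp add: a_def b_def algebra_simps flip: sum.distrib)
  moreover have "Im (\<Sum>i<n. \<Sum>j<n. complex_of_real (K i j) * x $ j * cnj (x $ i))
      = (\<Sum>i<n. \<Sum>j<n. a i * b j * K i j) - (\<Sum>i<n. \<Sum>j<n. a j * b i * K i j)"
    by (simp add: a_def b_def algebra_simps flip: sum_subtractf)
  moreover have "(\<Sum>i<n. \<Sum>j<n. a j * b i * K i j) = (\<Sum>i<n. \<Sum>j<n. a i * b j * K i j)"
    by (subst sum.swap) (simp add: sym[of _ _])
  ultimately show "0 \<le> (?A *\<^sub>v x) \<bullet>c x"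
    using psd by (simp add: less_eq_complex_def psd_kernel_def)
qed simp

section \<open>Determinant identities\<close>

lemma det_mat:
  "Determinant.det (mat n n f) =
     (\<Sum>p | p permutes {0..<n}. signof p * (\<Prod>i = 0..<n. (f (i, p i) :: 'a :: comm_ring_1)))"
proof -
  have "Determinant.det (mat n n f) =
      (\<Sum>p | p permutes {0..<n}. signof p * (\<Prod>i = 0..<n. mat n n f $$ (i, p i)))"
    by (rule det_def') simp
  also have "\<dots> = (\<Sum>p | p permutes {0..<n}. signof p * (\<Prod>i = 0..<n. f (i, p i)))"
  proof (intro sum.cong refl arg_cong2[where f = "(*)"] prod.cong)
    fix p i
    assume "p \<in> {p. p permutes {0..<n}}" "i \<in> {0..<n}"
    then show "mat n n f $$ (i, p i) = f (i, p i)"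
      using permutes_in_image[of p "{0..<n}" i] by simp
  qed
  finally show ?thesis .
qed

lemma det_scale_rows:
  fixes r :: "nat \<Rightarrow> 'a :: comm_ring_1"
  shows "Determinant.det (mat n n (\<lambda>(i, j). r i * f i j))
     = (\<Prod>i<n. r i) * Determinant.det (mat n n (\<lambda>(i, j). f i j))"
  by (simp add: det_mat prod.distrib sum_distrib_left lessThan_atLeast0 mult_ac)

lemma det_scale_columns:
  fixes c :: "nat \<Rightarrow> 'a :: comm_ring_1"
  shows "Determinant.det (mat n n (\<lambda>(i, j). c j * f i j))
     = (\<Prod>j<n. c j) * Determinant.det (mat n n (\<lambda>(i, j). f i j))"
proof -
  have "(\<Prod>i = 0..<n. c (p i)) = (\<Prod>j<n. c j)" if "p permutes {0..<n}" for p
    using prod.permute[OF that, of c] by (simp add: o_def lessThan_atLeast0)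
  then show ?thesis
    by (simp add: det_mat prod.distrib sum_distrib_left mult_ac)
qed

lemma det_sum_rows:
  fixes f :: "nat \<Rightarrow> 'b \<Rightarrow> nat \<Rightarrow> 'a :: comm_ring_1"
  assumes "\<And>i. i < n \<Longrightarrow> finite (S i)"
  shows "Determinant.det (mat n n (\<lambda>(i, j). \<Sum>s\<in>S i. f i s j))
     = (\<Sum>g\<in>PiE {0..<n} S. Determinant.det (mat n n (\<lambda>(i, j). f i (g i) j)))"
proof -
  have "(\<Prod>i = 0..<n. \<Sum>s\<in>S i. f i s (p i)) = (\<Sum>g\<in>PiE {0..<n} S. \<Prod>i = 0..<n. f i (g i) (p i))" for p
    using assms by (intro prod_sum_PiE) auto
  then show ?thesis
    by (simp add: det_mat sum_distrib_left) (rule sum.swap)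
qed

text \<open>
  Subtracting from each row its predecessor clears the constant column below the diagonal, and
  expansion along that column then leaves the matrix of differences.
\<close>

lemma det_constant_first_column:
  fixes f :: "nat \<Rightarrow> nat \<Rightarrow> 'a :: idom"
  assumes one: "\<And>i. f i 0 = 1"
  shows "Determinant.det (mat (Suc k) (Suc k) (\<lambda>(i, j). f i j))
     = Determinant.det (mat k k (\<lambda>(i, j). f (Suc i) (Suc j) - f i (Suc j)))"
proof -
  let ?n = "Suc k"
  define A where "A = mat ?n ?n (\<lambda>(i, j). f i j)"
  define E :: "'a mat" where
    "E = mat ?n ?n (\<lambda>(i, j). (if j = i then 1 else 0) - (if Suc j = i then 1 else 0))"
  define B where "B = mat ?n ?n (\<lambda>(i, j). if i = 0 then f 0 j else f i j - f (i - 1) j)"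
  have carrier: "A \<in> carrier_mat ?n ?n" "E \<in> carrier_mat ?n ?n" "B \<in> carrier_mat ?n ?n"
    by (simp_all add: A_def E_def B_def)
  have "E * A = B"
  proof (rule eq_matI)
    fix i j
    assume "i < dim_row B" "j < dim_col B"
    then have ij: "i < ?n" "j < ?n"
      by (simp_all add: B_def)
    have "(E * A) $$ (i, j) = (\<Sum>l<?n. E $$ (i, l) * A $$ (l, j))"
      using ij carrier by (simp add: scalar_prod_def lessThan_atLeast0)
    also have "\<dots> = (\<Sum>l<?n. (if l = i then f l j else 0) - (if Suc l = i then f l j else 0))"
      using ij by (intro sum.cong refl) (simp add: E_def A_def)
    also have "\<dots> = B $$ (i, j)"
      using ij by (cases i) (simp_all add: B_def sum_subtractf del: sum.lessThan_Suc)
    finally show "(E * A) $$ (i, j) = B $$ (i, j)" .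
  qed (use carrier in auto)
  moreover have "Determinant.det E = 1"
  proof -
    have "Determinant.det E = prod_list (diag_mat E)"
      by (rule det_lower_triangular[of ?n]) (auto simp: E_def)
    also have "\<dots> = 1"
      by (simp add: prod_list_diag_prod E_def)
    finally show ?thesis .
  qed
  ultimately have "Determinant.det A = Determinant.det B"
    using det_mult[OF carrier(2) carrier(1)] by simp
  also have "\<dots> = (\<Sum>i<?n. B $$ (i, 0) * cofactor B i 0)"
    using carrier(3) by (rule laplace_expansion_column) simp
  also have "\<dots> = (\<Sum>i<?n. if i = 0 then cofactor B 0 0 else 0)"
    by (intro sum.cong refl) (simp add: B_def one)
  also have "\<dots> = Determinant.det (mat_delete B 0 0)"
    by (simp add: cofactor_def del: sum.lessThan_Suc)
  also have "mat_delete B 0 0 = mat k k (\<lambda>(i, j). f (Suc i) (Suc j) - f i (Suc j))"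
    by (rule eq_matI) (simp_all add: mat_delete_def B_def)
  finally show ?thesis
    by (simp add: A_def)
qed

section \<open>Determinants of rising factorials\<close>

text \<open>
  The unit step of the rising factorial, \<open>(s + 1)\<^sub>m - (s)\<^sub>m = m (s + 1)\<^sub>m\<^sub>-\<^sub>1\<close>, summed over an interval.
\<close>

lemma pochhammer_diff_sum:
  assumes "a \<le> b"
  shows "pochhammer (real b) (Suc m) - pochhammer (real a) (Suc m)
     = (\<Sum>s = a..<b. real (Suc m) * pochhammer (real (Suc s)) m)"
proof -
  have step: "pochhammer (real (Suc s)) (Suc m) - pochhammer (real s) (Suc m)
      = real (Suc m) * pochhammer (real (Suc s)) m" for s
  proof -
    have "pochhammer (real s) (Suc m) = real s * pochhammer (real (Suc s)) m"
      by (simp add: pochhammer_rec add.commute)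
    moreover have "pochhammer (real (Suc s)) (Suc m)
        = (real (Suc s) + real m) * pochhammer (real (Suc s)) m"
      by (rule pochhammer_rec')
    ultimately show ?thesis
      by (simp only: of_nat_Suc) (simp add: algebra_simps)
  qed
  show ?thesis
    using sum_Suc_diff'[OF assms, of "\<lambda>s. pochhammer (real s) (Suc m)"] by (simp only: step)
qed

lemma det_pochhammer_pos:
  assumes "\<And>i j. i < j \<Longrightarrow> j < k \<Longrightarrow> x i < (x j :: nat)"
    and "\<And>i. i < k \<Longrightarrow> 0 < x i"
    and "\<And>i j. i < j \<Longrightarrow> j < k \<Longrightarrow> m i < (m j :: nat)"
  shows "0 < Determinant.det (mat k k (\<lambda>(i, j). pochhammer (real (x i)) (m j)))"
  using assms
proof (induction k arbitrary: x m)
  case 0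
  then show ?case
    by (simp add: det_dim_zero)
next
  case (Suc k)
  note x = Suc.prems(1) and x_pos = Suc.prems(2) and m = Suc.prems(3)
  \<comment> \<open>Splitting off the order \<open>m\<^sub>0\<close> from every row shifts the nodes to \<open>y\<close> and makes the first order zero.\<close>
  define y where "y i = x i + m 0" for i
  define f where "f i j = pochhammer (real (y i)) (m j - m 0)" for i j
  have m0: "m 0 \<le> m j" if "j < Suc k" for j
    using m[of 0 j] that by (cases j) auto
  have "mat (Suc k) (Suc k) (\<lambda>(i, j). pochhammer (real (x i)) (m j))
      = mat (Suc k) (Suc k) (\<lambda>(i, j). pochhammer (real (x i)) (m 0) * f i j)"
    by (rule eq_matI)
      (auto simp: f_def y_def intro!: pochhammer_product m0)
  then have det_f: "Determinant.det (mat (Suc k) (Suc k) (\<lambda>(i, j). pochhammer (real (x i)) (m j)))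
      = (\<Prod>i<Suc k. pochhammer (real (x i)) (m 0)) * Determinant.det (mat (Suc k) (Suc k) (\<lambda>(i, j). f i j))"
    by (simp only: det_scale_rows)
  define q where "q j = m (Suc j) - m 0 - 1" for j
  have q: "m (Suc j) - m 0 = Suc (q j)" if "j < k" for j
    using m[of 0 "Suc j"] that by (simp add: q_def)
  have "Determinant.det (mat (Suc k) (Suc k) (\<lambda>(i, j). f i j))
      = Determinant.det (mat k k (\<lambda>(i, j). f (Suc i) (Suc j) - f i (Suc j)))"
    by (rule det_constant_first_column) (simp add: f_def)
  also have "mat k k (\<lambda>(i, j). f (Suc i) (Suc j) - f i (Suc j))
      = mat k k (\<lambda>(i, j). real (Suc (q j)) *
          (\<Sum>s\<in>{y i..<y (Suc i)}. pochhammer (real (Suc s)) (q j)))"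
  proof (rule cong_mat[OF refl refl])
    fix i j
    assume ij: "i < k" "j < k"
    have "y i \<le> y (Suc i)"
      using x[of i "Suc i"] ij by (simp add: y_def)
    then show "(\<lambda>(i, j). f (Suc i) (Suc j) - f i (Suc j)) (i, j)
      = (\<lambda>(i, j). real (Suc (q j)) *
          (\<Sum>s\<in>{y i..<y (Suc i)}. pochhammer (real (Suc s)) (q j))) (i, j)"
      by (simp only: f_def q[OF ij(2)] pochhammer_diff_sum sum_distrib_left prod.case)
  qed
  also have "Determinant.det \<dots> = (\<Prod>j<k. real (Suc (q j))) *
      Determinant.det (mat k k (\<lambda>(i, j). \<Sum>s\<in>{y i..<y (Suc i)}. pochhammer (real (Suc s)) (q j)))"
    by (rule det_scale_columns)
  also have "Determinant.det (mat k k (\<lambda>(i, j). \<Sum>s\<in>{y i..<y (Suc i)}. pochhammer (real (Suc s)) (q j)))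
      = (\<Sum>g\<in>PiE {0..<k} (\<lambda>i. {y i..<y (Suc i)}).
           Determinant.det (mat k k (\<lambda>(i, j). pochhammer (real (Suc (g i))) (q j))))"
    by (rule det_sum_rows) simp
  finally have det_g: "Determinant.det (mat (Suc k) (Suc k) (\<lambda>(i, j). f i j))
      = (\<Prod>j<k. real (Suc (q j))) * (\<Sum>g\<in>PiE {0..<k} (\<lambda>i. {y i..<y (Suc i)}).
           Determinant.det (mat k k (\<lambda>(i, j). pochhammer (real (Suc (g i))) (q j))))" .
  have "0 < (\<Sum>g\<in>PiE {0..<k} (\<lambda>i. {y i..<y (Suc i)}).
           Determinant.det (mat k k (\<lambda>(i, j). pochhammer (real (Suc (g i))) (q j))))"
  proof (rule sum_pos)
    show "finite (PiE {0..<k} (\<lambda>i. {y i..<y (Suc i)}))"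
      by (intro finite_PiE) auto
    show "PiE {0..<k} (\<lambda>i. {y i..<y (Suc i)}) \<noteq> {}"
      using x by (auto simp: PiE_eq_empty_iff y_def not_le)
    fix g
    assume g: "g \<in> PiE {0..<k} (\<lambda>i. {y i..<y (Suc i)})"
    have g_bounds: "y i \<le> g i" "g i < y (Suc i)" if "i < k" for i
      using PiE_mem[OF g, of i] that by auto
    show "0 < Determinant.det (mat k k (\<lambda>(i, j). pochhammer (real (Suc (g i))) (q j)))"
    proof (rule Suc.IH)
      fix i j
      assume ij: "i < j" "j < k"
      have "x (Suc i) \<le> x j"
        using x[of "Suc i" j] ij by (cases "Suc i = j") auto
      then have "y (Suc i) \<le> y j"
        by (simp add: y_def)
      then show "Suc (g i) < Suc (g j)"
        using g_bounds[of i] g_bounds[of j] ij by simp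
      show "q i < q j"
        using q[of i] q[of j] m[of "Suc i" "Suc j"] ij by simp
    qed simp
  qed
  moreover have "0 < (\<Prod>i<Suc k. pochhammer (real (x i)) (m 0))"
    using x_pos by (intro prod_pos) (auto intro!: pochhammer_pos)
  moreover have "0 < (\<Prod>j<k. real (Suc (q j)))"
    by (intro prod_pos) simp
  ultimately show ?case
    by (simp only: det_f det_g mult_pos_pos)
qed

section \<open>The reciprocal beta matrix\<close>

lemma reciprocal_beta_powr:
  "(1 / Beta (real (i + 1)) (real (j + 1))) powr r
     = Gamma (real (i + 1)) powr (- r) * Gamma (real (j + 1)) powr (- r)
       * Gamma (real (i + 1) + real (j + 1)) powr r"
proof -
  have pos: "0 < Gamma (real (i + 1))" "0 < Gamma (real (j + 1))"
    "0 < Gamma (real (i + 1) + real (j + 1))"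
    by (intro Gamma_real_pos; simp)+
  have "1 / Beta (real (i + 1)) (real (j + 1))
      = Gamma (real (i + 1) + real (j + 1)) / (Gamma (real (i + 1)) * Gamma (real (j + 1)))"
    by (simp add: Beta_def)
  then show ?thesis
    using pos by (simp only: powr_divide powr_mult powr_minus less_imp_le mult_nonneg_nonneg)
      (simp add: divide_inverse mult_ac)
qed

lemma reciprocal_beta_pochhammer:
  "1 / Beta (real (i + 1)) (real (j + 1)) = pochhammer (real (i + 1)) (j + 1) / fact j"
proof -
  have "real (i + 1) \<notin> \<int>\<^sub>\<le>\<^sub>0"
    by (auto elim!: nonpos_Ints_cases)
  then have "pochhammer (real (i + 1)) (j + 1)
      = Gamma (real (i + 1) + real (j + 1)) / Gamma (real (i + 1))"
    by (rule pochhammer_Gamma)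
  moreover have "Gamma (real (j + 1)) = fact j"
    using Gamma_fact[of j, where 'a = real] by (simp add: add.commute)
  ultimately show ?thesis
    by (simp add: Beta_def)
qed

lemma infinitely_divisible_reciprocal_beta_matrix:
  "infinitely_divisible (reciprocal_beta_matrix n)"
  unfolding infinitely_divisible_def
proof (intro conjI allI impI)
  show "square_mat (reciprocal_beta_matrix n)"
    by (simp add: reciprocal_beta_matrix_def)
next
  fix i j
  assume "i < dim_row (reciprocal_beta_matrix n)" "j < dim_col (reciprocal_beta_matrix n)"
  then have "reciprocal_beta_matrix n $$ (i, j) = pochhammer (real (i + 1)) (j + 1) / fact j"
    by (simp only: reciprocal_beta_pochhammer[symmetric]) (simp add: reciprocal_beta_matrix_def)
  then show "0 \<le> reciprocal_beta_matrix n $$ (i, j)"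
    using pochhammer_nonneg[of "real (i + 1)" "j + 1"] by simp
next
  fix r :: real
  assume r: "0 < r"
  define K where "K i j = (1 / Beta (real (i + 1)) (real (j + 1))) powr r" for i j
  have "psd_kernel n K"
    unfolding K_def reciprocal_beta_powr
    using r by (intro psd_kernel_congruence psd_kernel_Gamma_power) auto
  moreover have "K i j = K j i" for i j
    by (simp add: K_def Beta_commute)
  ultimately have "positive_semidefinite (mat n n (\<lambda>(i, j). complex_of_real (K i j)))"
    by (rule positive_semidefinite_psd_kernel)
  moreover have "map_mat complex_of_real (entrywise_power (reciprocal_beta_matrix n) r)
      = mat n n (\<lambda>(i, j). complex_of_real (K i j))"
    by (rule eq_matI) (simp_all add: entrywise_power_def reciprocal_beta_matrix_def K_def)
  ultimately show "positive_semidefinite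
      (map_mat complex_of_real (entrywise_power (reciprocal_beta_matrix n) r))"
    by simp
qed

lemma totally_positive_reciprocal_beta_matrix:
  "totally_positive (reciprocal_beta_matrix n)"
  unfolding totally_positive_def
proof (intro allI impI)
  fix I J
  assume I: "I \<subseteq> {..<dim_row (reciprocal_beta_matrix n)}"
    and J: "J \<subseteq> {..<dim_col (reciprocal_beta_matrix n)}"
    and card: "card I = card J"
  define k where "k = card I"
  have IJ: "I \<subseteq> {..<n}" "J \<subseteq> {..<n}"
    using I J by (simp_all add: reciprocal_beta_matrix_def)
  then have sets: "{i. i < n \<and> i \<in> I} = I" "{j. j < n \<and> j \<in> J} = J"
    by auto
  have "submatrix (reciprocal_beta_matrix n) I J = mat k k (\<lambda>(i, j).
      1 / fact (pick J j) * pochhammer (real (pick I i + 1)) (pick J j + 1))"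
  proof (rule eq_matI)
    fix i j
    assume "i < dim_row (mat k k (\<lambda>(i, j).
        1 / fact (pick J j) * pochhammer (real (pick I i + 1)) (pick J j + 1)))"
      "j < dim_col (mat k k (\<lambda>(i, j).
        1 / fact (pick J j) * pochhammer (real (pick I i + 1)) (pick J j + 1)))"
    then have ij: "i < card I" "j < card J" "i < k" "j < k"
      using card by (simp_all add: k_def)
    then have "pick I i < n" "pick J j < n"
      using pick_in_set_le[of i I] pick_in_set_le[of j J] IJ by auto
    moreover have "submatrix (reciprocal_beta_matrix n) I J $$ (i, j)
        = reciprocal_beta_matrix n $$ (pick I i, pick J j)"
      using ij by (intro submatrix_index) (simp_all add: reciprocal_beta_matrix_def sets)
    ultimately have "submatrix (reciprocal_beta_matrix n) I J $$ (i, j)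
        = 1 / Beta (real (pick I i + 1)) (real (pick J j + 1))"
      by (simp add: reciprocal_beta_matrix_def)
    then show "submatrix (reciprocal_beta_matrix n) I J $$ (i, j) = mat k k (\<lambda>(i, j).
        1 / fact (pick J j) * pochhammer (real (pick I i + 1)) (pick J j + 1)) $$ (i, j)"
      unfolding reciprocal_beta_pochhammer using ij by simp
  qed (simp_all add: dim_submatrix reciprocal_beta_matrix_def sets card k_def)
  then have "Determinant.det (submatrix (reciprocal_beta_matrix n) I J) =
      (\<Prod>j<k. 1 / fact (pick J j)) * Determinant.det (mat k k (\<lambda>(i, j).
        pochhammer (real (pick I i + 1)) (pick J j + 1)))"
    by (simp only: det_scale_columns)
  moreover have "0 < Determinant.det (mat k k (\<lambda>(i, j).
      pochhammer (real (pick I i + 1)) (pick J j + 1)))"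
    using card by (intro det_pochhammer_pos) (simp_all add: k_def pick_mono_le)
  moreover have "0 < (\<Prod>j<k. 1 / fact (pick J j) :: real)"
    by (intro prod_pos) simp
  ultimately show "0 < Determinant.det (submatrix (reciprocal_beta_matrix n) I J)"
    by simp
qed

theorem theorem2p1:
  fixes n :: nat
  assumes "n \<ge> 1"
  shows "infinitely_divisible (reciprocal_beta_matrix n) \<and> totally_positive (reciprocal_beta_matrix n)"
  by (intro conjI infinitely_divisible_reciprocal_beta_matrix totally_positive_reciprocal_beta_matrix)

end
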